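(* Let $H=Gb_*+\varepsilon$ with $H,\varepsilon\in\mathbb{R}^n$, $G\in\mathbb{R}^{n\times p}$, $b_*\in\mathbb{R}^p$, and let $\sigma\mapsto\mathcal{B}(\sigma)$ be a map assigning to each $\sigma\ge0$ a set $\mathcal{B}(\sigma)\subseteq\mathbb{R}^p$ with $\mathcal{B}(\sigma_1)\subseteq\mathcal{B}(\sigma_2)$ whenever $\sigma_1\le\sigma_2$. Suppose there exist $\eta,\kappa,\sigma_*>0$ such that (i) $\|n^{-1}G^\top\varepsilon\|_\infty\le\eta\sigma_*$; (ii) $3\sigma_*^2/4\le n^{-1}\|\varepsilon\|_2^2\le2\sigma_*^2$; (iii) $b_*\in\mathcal{B}(\sigma_* )$; (iv) $28\eta\sqrt{\|b_*\|_0/\kappa}\le1$; (v) $$\min_{J_0\subseteq\{1,\dots,p\},\ |J_0|\le\|b_*\|_0}\ \ \min_{a\ne0,\ \|a_{J_0^c}\|_1\le\|a_{J_0}\|_1}\ \frac{\|Ga\|_2^2}{n\|a_{J_0}\|_2^2}\ \ge\ \kappa.$$ Let $\tilde\sigma$ and $\widetilde b$ be the generalized ADDS quantities defined in the context with this $\eta$, and let $\hat\sigma=n^{-1/2}\|H-G\widetilde b\|_2$. Then $$\sigma_*\le\tilde\sigma\le3\sigma_*,$$ $$\|G(\widetilde b-b_* )\|_2\le8\sigma_*\eta\sqrt{n\|b_*\|_0/\kappa},$$ $$\|\widetilde b-b_*\|_1\le16\eta\sigma_*\|b_*\|_0/\kappa,$$ $$\sigma_*/\sqrt2\le\hat\sigma\le2\sigma_*,$$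 $$\|n^{-1}G^\top(H-G\widetilde b)\|_\infty\,\hat\sigma^{-1}\le3\sqrt2\,\eta.$$
   Context: Generalized Auto-aDaptive Dantzig Selector (ADDS): for $\sigma\ge0$, $\hat b(\sigma)$ is a minimizer of $\|b\|_1$ over $b\in\mathbb{R}^p$ subject to $\|n^{-1}G^\top(H-Gb)\|_\infty\le\eta\sigma$ and $b\in\mathcal{B}(\sigma)$. Then $\tilde\sigma$ is the maximizer of $\sigma$ over $\sigma\ge0$ subject to $\|H-G\hat b(\sigma)\|_2^2\ge n\sigma^2/2$, and $\widetilde b=\hat b(\tilde\sigma)$. These minimizers and the maximizer are assumed to exist (in the maximization, $\sigma$ ranges over values for which $\hat b(\sigma)$ is defined, including $\sigma_*$), with one fixed choice of minimizer $\hat b(\sigma)$ for each $\sigma$. Notation: $\|b\|_0=\#\{j:b_j\ne0\}$; for an index set $J$, $a_J$ is the subvector of $a$ with indices in $J$ and $J^c$ is the complement in $\{1,\dots,p\}$; $\|\cdot\|_q$ is the usual $\ell_q$ norm and $\|\cdot\|_\infty$ the maximum absolute entry. *)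

theory Defs
  imports "HOL-Analysis.Analysis"
begin

definition l0_norm :: "real ^ 'p \<Rightarrow> nat" where
  "l0_norm b = card {j. b $ j \<noteq> 0}"

definition l1_norm :: "real ^ 'p \<Rightarrow> real" where
  "l1_norm b = (\<Sum>j\<in>UNIV. \<bar>b $ j\<bar>)"

text \<open>The subvector of \<open>a\<close> with indices in \<open>J\<close>, padded with zeros outside \<open>J\<close>;
  the padding does not affect any of its norms.\<close>

definition subvec :: "'p set \<Rightarrow> real ^ 'p \<Rightarrow> real ^ 'p" where
  "subvec J a = (\<chi> j. if j \<in> J then a $ j else 0)"

text \<open>The minimum over index sets of size at most \<open>s\<close> and over the associated cones. It is an
  extended real because a cone may contain no nonzero vector (as for \<open>J = {}\<close>), in which case
  the minimum is \<open>\<infinity>\<close>. On the set of admissible \<open>a\<close> the denominator is positive.\<close>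

definition restricted_eigenvalue :: "real ^ 'p ^ 'n \<Rightarrow> nat \<Rightarrow> ereal" where
  "restricted_eigenvalue G s =
     (INF J \<in> {J :: 'p set. card J \<le> s}.
        INF a \<in> {a. a \<noteq> 0 \<and> l1_norm (subvec (- J) a) \<le> l1_norm (subvec J a)}.
          ereal ((norm (G *v a))\<^sup>2 / (real CARD('n) * (norm (subvec J a))\<^sup>2)))"

definition adds_feasible ::
  "real ^ 'p ^ 'n \<Rightarrow> real ^ 'n \<Rightarrow> (real \<Rightarrow> (real ^ 'p) set) \<Rightarrow> real \<Rightarrow> real \<Rightarrow> real ^ 'p \<Rightarrow> bool" where
  "adds_feasible G H B \<eta> \<sigma> b \<longleftrightarrow>
     infnorm ((1 / real CARD('n)) *\<^sub>R (transpose G *v (H - G *v b))) \<le> \<eta> * \<sigma> \<and> b \<in> B \<sigma>"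

text \<open>A fixed choice of a minimizer for every \<open>\<sigma>\<close> in the domain of the partial function
  \<open>bhat\<close>.\<close>

definition adds_selection ::
  "real ^ 'p ^ 'n \<Rightarrow> real ^ 'n \<Rightarrow> (real \<Rightarrow> (real ^ 'p) set) \<Rightarrow> real \<Rightarrow> (real \<rightharpoonup> real ^ 'p) \<Rightarrow> bool" where
  "adds_selection G H B \<eta> bhat \<longleftrightarrow>
     (\<forall>\<sigma> b. bhat \<sigma> = Some b \<longrightarrow> \<sigma> \<ge> 0 \<and> is_arg_min l1_norm (adds_feasible G H B \<eta> \<sigma>) b)"

definition adds_scale ::
  "real ^ 'p ^ 'n \<Rightarrow> real ^ 'n \<Rightarrow> (real \<rightharpoonup> real ^ 'p) \<Rightarrow> real \<Rightarrow> bool" where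
  "adds_scale G H bhat \<sigma>t \<longleftrightarrow>
     is_arg_max (\<lambda>\<sigma>. \<sigma>)
       (\<lambda>\<sigma>. \<sigma> \<ge> 0 \<and> (\<exists>b. bhat \<sigma> = Some b \<and>
          (norm (H - G *v b))\<^sup>2 \<ge> real CARD('n) * \<sigma>\<^sup>2 / 2)) \<sigma>t"

end

theory Submission
  imports Defs
begin

text \<open>
  The argument rests on one deterministic estimate, \<open>restricted_eigenvalue_error_bound\<close>: if \<open>b\<close>
  has no larger \<open>\<ell>\<^sub>1\<close> norm than \<open>bs\<close>, then \<open>a = b - bs\<close> lies in the cone on which the
  restricted eigenvalue is measured (with \<open>J\<close> the support of \<open>bs\<close>), and a bound \<open>\<mu>\<close> on the
  absolute entries of \<open>n\<inverse> G\<^sup>T G a\<close> then controls both \<open>\<parallel>G a\<parallel>\<^sub>2\<close> and \<open>\<parallel>a\<parallel>\<^sub>1\<close>. Indeed duality gives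
  \<open>\<parallel>G a\<parallel>\<^sup>2 \<le> n \<mu> \<parallel>a\<parallel>\<^sub>1\<close>, while the cone and the eigenvalue give \<open>\<parallel>a\<parallel>\<^sub>1 \<le> 2 sqrt (s / (n \<kappa>)) \<parallel>G a\<parallel>\<close>;
  substituting the second into the first leaves a bound that is linear in \<open>\<parallel>G a\<parallel>\<close>.

  As \<open>B\<close> is monotone, \<open>bs\<close> is feasible for every \<open>\<sigma> \<ge> \<sigma>s\<close>, so the estimate applies to each
  selected \<open>bhat \<sigma>\<close> with \<open>\<mu> = \<eta> (\<sigma> + \<sigma>s)\<close>. By the sparsity condition the prediction error is at
  most \<open>(\<sigma> + \<sigma>s) sqrt n / 14\<close> (\<open>adds_error_bounds\<close>).

  The scale \<open>\<sigma>t\<close> is located by comparing the residual with the noise level. At \<open>\<sigma> = \<sigma>s\<close> the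
  residual norm divided by \<open>sqrt n\<close> is at least \<open>(sqrt 3 / 2 - 1 / 7) \<sigma>s \<ge> \<sigma>s / sqrt 2\<close>, so \<open>\<sigma>s\<close>
  competes in the maximization and \<open>\<sigma>s \<le> \<sigma>t\<close>. At \<open>\<sigma> = \<sigma>t\<close> it is at least \<open>\<sigma>t / sqrt 2\<close>, and at
  most \<open>sqrt 2 \<sigma>s + (\<sigma>t + \<sigma>s) / 14\<close>, which forces \<open>\<sigma>t \<le> 3 \<sigma>s\<close>. Everything else is read off from
  these two bounds on \<open>\<sigma>t\<close>.
\<close>

section \<open>Duality and norms of subvectors\<close>

lemma inner_le_l1_norm_infnorm:
  fixes x y :: "real ^ 'p"
  shows "x \<bullet> y \<le> l1_norm x * infnorm y"
proof -
  have "x \<bullet> y = (\<Sum>j\<in>UNIV. x $ j * y $ j)"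
    by (simp add: inner_vec_def)
  also have "\<dots> \<le> (\<Sum>j\<in>UNIV. \<bar>x $ j\<bar> * infnorm y)"
  proof (rule sum_mono)
    fix j
    have "x $ j * y $ j \<le> \<bar>x $ j\<bar> * \<bar>y $ j\<bar>"
      by (metis abs_ge_self abs_mult)
    also have "\<dots> \<le> \<bar>x $ j\<bar> * infnorm y"
      by (simp add: component_le_infnorm_cart mult_left_mono)
    finally show "x $ j * y $ j \<le> \<bar>x $ j\<bar> * infnorm y" .
  qed
  finally show ?thesis
    by (simp add: l1_norm_def sum_distrib_right)
qed

lemma l1_norm_subvec:
  fixes a :: "real ^ 'p"
  shows "l1_norm (subvec J a) = (\<Sum>j\<in>J. \<bar>a $ j\<bar>)"
proof -
  have "l1_norm (subvec J a) = (\<Sum>j\<in>UNIV. if j \<in> J then \<bar>a $ j\<bar> else 0)"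
    unfolding l1_norm_def subvec_def by (rule sum.cong) auto
  then show ?thesis
    by (simp add: sum.If_cases)
qed

lemma norm_subvec:
  fixes a :: "real ^ 'p"
  shows "norm (subvec J a) = L2_set (\<lambda>j. a $ j) J"
proof -
  have "(\<Sum>j\<in>UNIV. (norm (subvec J a $ j))\<^sup>2) = (\<Sum>j\<in>UNIV. if j \<in> J then (a $ j)\<^sup>2 else 0)"
    unfolding subvec_def by (rule sum.cong) auto
  then show ?thesis
    unfolding norm_vec_def L2_set_def by (simp add: sum.If_cases)
qed

lemma l1_norm_split:
  fixes a :: "real ^ 'p"
  shows "l1_norm a = l1_norm (subvec J a) + l1_norm (subvec (- J) a)"
proof -
  have "l1_norm a = (\<Sum>j\<in>J \<union> - J. \<bar>a $ j\<bar>)"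
    by (simp add: l1_norm_def)
  also have "\<dots> = (\<Sum>j\<in>J. \<bar>a $ j\<bar>) + (\<Sum>j\<in>- J. \<bar>a $ j\<bar>)"
    by (rule sum.union_disjoint) auto
  finally show ?thesis
    by (simp add: l1_norm_subvec)
qed

lemma l1_norm_subvec_le_norm:
  fixes a :: "real ^ 'p"
  shows "l1_norm (subvec J a) \<le> sqrt (real (card J)) * norm (subvec J a)"
  using L2_set_mult_ineq[of "\<lambda>_. 1" "\<lambda>j. a $ j" J]
  by (simp add: l1_norm_subvec norm_subvec L2_set_def)

section \<open>The \<open>\<ell>\<^sub>1\<close> cone and the restricted eigenvalue\<close>

text \<open>A perturbation of \<open>bs\<close> that does not increase the \<open>\<ell>\<^sub>1\<close> norm must pay for every entry it
  creates off the support by shrinking entries on the support.\<close>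

lemma l1_decrease_imp_cone:
  fixes b bs :: "real ^ 'p"
  assumes "l1_norm b \<le> l1_norm bs"
  shows "l1_norm (subvec (- {j. bs $ j \<noteq> 0}) (b - bs))
    \<le> l1_norm (subvec {j. bs $ j \<noteq> 0} (b - bs))"
proof -
  let ?J = "{j. bs $ j \<noteq> 0}"
  have off: "l1_norm (subvec (- ?J) (b - bs)) = l1_norm (subvec (- ?J) b)"
    "l1_norm (subvec (- ?J) bs) = 0"
    by (simp_all add: l1_norm_subvec)
  have "l1_norm (subvec ?J bs) - l1_norm (subvec ?J b) \<le> l1_norm (subvec ?J (b - bs))"
    unfolding l1_norm_subvec sum_subtractf[symmetric] by (rule sum_mono) auto
  then show ?thesis
    using assms l1_norm_split[of b ?J] l1_norm_split[of bs ?J] off by linarith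
qed

lemma restricted_eigenvalueD:
  fixes G :: "real ^ 'p ^ 'n" and a :: "real ^ 'p"
  assumes re: "restricted_eigenvalue G s \<ge> ereal \<kappa>"
    and J: "card J \<le> s"
    and cone: "l1_norm (subvec (- J) a) \<le> l1_norm (subvec J a)"
  shows "\<kappa> * real CARD('n) * (norm (subvec J a))\<^sup>2 \<le> (norm (G *v a))\<^sup>2"
proof (cases "subvec J a = 0")
  case True
  then show ?thesis by simp
next
  case False
  have "a \<noteq> 0"
    using False by (auto simp: subvec_def vec_eq_iff split: if_splits)
  have "restricted_eigenvalue G s
      \<le> ereal ((norm (G *v a))\<^sup>2 / (real CARD('n) * (norm (subvec J a))\<^sup>2))"
    unfolding restricted_eigenvalue_def
    by (rule INF_lower2[of J], use J in simp, rule INF_lower) (use \<open>a \<noteq> 0\<close> cone in simp)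
  with re have "\<kappa> \<le> (norm (G *v a))\<^sup>2 / (real CARD('n) * (norm (subvec J a))\<^sup>2)"
    using order_trans ereal_less_eq(3) by blast
  then show ?thesis
    using False by (simp add: pos_le_divide_eq mult.assoc)
qed

text \<open>The quadratic \<open>\<parallel>G a\<parallel>\<^sup>2 = a \<bullet> G\<^sup>T G a\<close> is linear in \<open>\<parallel>a\<parallel>\<^sub>1\<close> by duality, whereas on the cone
  \<open>\<parallel>a\<parallel>\<^sub>1\<close> is linear in \<open>\<parallel>G a\<parallel>\<close>. Cancelling one factor
  \<open>\<parallel>G a\<parallel>\<close> gives the first bound, and feeding it back into the cone inequality the second.\<close>

lemma restricted_eigenvalue_error_bound:
  fixes G :: "real ^ 'p ^ 'n" and b bs :: "real ^ 'p"
  assumes \<kappa>: "\<kappa> > 0"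
    and re: "restricted_eigenvalue G (l0_norm bs) \<ge> ereal \<kappa>"
    and l1: "l1_norm b \<le> l1_norm bs"
    and corr: "infnorm ((1 / real CARD('n)) *\<^sub>R (transpose G *v (G *v (b - bs)))) \<le> \<mu>"
  shows "norm (G *v (b - bs)) \<le> 2 * \<mu> * sqrt (real CARD('n) * real (l0_norm bs) / \<kappa>)"
    and "l1_norm (b - bs) \<le> 4 * \<mu> * real (l0_norm bs) / \<kappa>"
proof -
  define n where "n = real CARD('n)"
  define J where "J = {j. bs $ j \<noteq> 0}"
  define s where "s = real (l0_norm bs)"
  define a where "a = b - bs"
  define x where "x = norm (G *v a)"
  define r where "r = sqrt (s / \<kappa>)"
  have n: "n > 0" and s: "s \<ge> 0" and x: "x \<ge> 0" and r: "r \<ge> 0"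
    using \<kappa> by (simp_all add: n_def s_def x_def r_def)
  have card: "card J = l0_norm bs"
    by (simp add: J_def l0_norm_def)
  have \<mu>: "\<mu> \<ge> 0"
    using corr infnorm_pos_le order_trans by blast
  have cone: "l1_norm (subvec (- J) a) \<le> l1_norm (subvec J a)"
    unfolding J_def a_def by (rule l1_decrease_imp_cone[OF l1])
  have "\<kappa> * n * (norm (subvec J a))\<^sup>2 \<le> x\<^sup>2"
    unfolding n_def x_def by (rule restricted_eigenvalueD[OF re _ cone]) (simp add: card)
  then have "(norm (subvec J a))\<^sup>2 \<le> x\<^sup>2 / (\<kappa> * n)"
    using \<kappa> n by (simp add: pos_le_divide_eq mult.commute)
  then have "norm (subvec J a) \<le> sqrt (x\<^sup>2 / (\<kappa> * n))"
    by (rule real_le_rsqrt)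
  also have "\<dots> = x / (sqrt \<kappa> * sqrt n)"
    using x by (simp add: real_sqrt_divide real_sqrt_mult)
  finally have norm_J: "norm (subvec J a) \<le> x / (sqrt \<kappa> * sqrt n)" .
  have "l1_norm a \<le> 2 * l1_norm (subvec J a)"
    using l1_norm_split[of a J] cone by linarith
  also have "\<dots> \<le> 2 * (sqrt s * norm (subvec J a))"
    using l1_norm_subvec_le_norm[of J a] by (simp add: card s_def)
  also have "\<dots> \<le> 2 * (sqrt s * (x / (sqrt \<kappa> * sqrt n)))"
    using norm_J s by (intro mult_left_mono) simp_all
  also have "\<dots> = 2 * r * x / sqrt n"
    by (simp add: r_def real_sqrt_divide)
  finally have l1_le: "l1_norm a \<le> 2 * r * x / sqrt n" .
  have "x\<^sup>2 = a \<bullet> (transpose G *v (G *v a))"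
    unfolding x_def power2_norm_eq_inner
    by (metis dot_lmul_matrix inner_commute transpose_matrix_vector)
  also have "\<dots> = n * (a \<bullet> ((1 / n) *\<^sub>R (transpose G *v (G *v a))))"
    using n by simp
  also have "\<dots> \<le> n * (l1_norm a * infnorm ((1 / n) *\<^sub>R (transpose G *v (G *v a))))"
    using n by (intro mult_left_mono inner_le_l1_norm_infnorm) simp
  also have "\<dots> \<le> n * (l1_norm a * \<mu>)"
    using corr n by (intro mult_left_mono) (simp_all add: n_def a_def l1_norm_def sum_nonneg)
  also have "\<dots> \<le> n * (2 * r * x / sqrt n * \<mu>)"
    using l1_le n \<mu> by (intro mult_left_mono mult_right_mono) simp_all
  also have "\<dots> = (n / sqrt n) * (2 * r * \<mu>) * x"
    by simp
  also have "\<dots> = (2 * \<mu> * (r * sqrt n)) * x"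
    using n by (simp add: real_div_sqrt)
  finally have "x * x \<le> (2 * \<mu> * (r * sqrt n)) * x"
    by (simp add: power2_eq_square)
  then have x_le: "x \<le> 2 * \<mu> * (r * sqrt n)"
    using x \<mu> r n by (cases "x = 0") simp_all
  also have "r * sqrt n = sqrt (n * s / \<kappa>)"
    unfolding r_def by (simp add: real_sqrt_mult[symmetric] mult.commute)
  finally show "norm (G *v (b - bs)) \<le> 2 * \<mu> * sqrt (real CARD('n) * real (l0_norm bs) / \<kappa>)"
    by (simp add: x_def a_def n_def s_def)
  have "l1_norm a \<le> 2 * r * (2 * \<mu> * (r * sqrt n)) / sqrt n"
    using l1_le x_le r n
    by (meson divide_right_mono mult_left_mono mult_nonneg_nonneg order_trans
        real_sqrt_ge_zero less_imp_le zero_le_numeral)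
  also have "\<dots> = 4 * \<mu> * r\<^sup>2"
    using n by (simp add: power2_eq_square)
  also have "r\<^sup>2 = s / \<kappa>"
    using s \<kappa> by (simp add: r_def)
  finally show "l1_norm (b - bs) \<le> 4 * \<mu> * real (l0_norm bs) / \<kappa>"
    by (simp add: a_def s_def)
qed

section \<open>Estimation error at a fixed scale\<close>

text \<open>Above the noise level \<open>\<sigma>s\<close> the true vector competes in the minimization, and the two
  feasibility constraints together bound the correlation of \<open>G (b - bs)\<close>, the difference of the
  noise and the residual, with the columns of \<open>G\<close>. The constant \<open>28\<close> turns the prediction bound
  into a small multiple of \<open>sqrt n\<close>, uniformly in the design.\<close>

lemma adds_error_bounds:
  fixes H \<epsilon> :: "real ^ 'n" and G :: "real ^ 'p ^ 'n" and b bs :: "real ^ 'p"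
  assumes H: "H = G *v bs + \<epsilon>"
    and mono: "mono_on {0..} B"
    and \<eta>: "\<eta> > 0" and \<kappa>: "\<kappa> > 0" and \<sigma>s: "\<sigma>s \<ge> 0" and le: "\<sigma>s \<le> \<sigma>"
    and noise: "infnorm ((1 / real CARD('n)) *\<^sub>R (transpose G *v \<epsilon>)) \<le> \<eta> * \<sigma>s"
    and bs: "bs \<in> B \<sigma>s"
    and sparse: "28 * \<eta> * sqrt (real (l0_norm bs) / \<kappa>) \<le> 1"
    and re: "restricted_eigenvalue G (l0_norm bs) \<ge> ereal \<kappa>"
    and b: "is_arg_min l1_norm (adds_feasible G H B \<eta> \<sigma>) b"
  shows "norm (G *v (b - bs))
      \<le> 2 * (\<eta> * (\<sigma> + \<sigma>s)) * sqrt (real CARD('n) * real (l0_norm bs) / \<kappa>)"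
    and "l1_norm (b - bs) \<le> 4 * (\<eta> * (\<sigma> + \<sigma>s)) * real (l0_norm bs) / \<kappa>"
    and "norm (G *v (b - bs)) \<le> (\<sigma> + \<sigma>s) / 14 * sqrt (real CARD('n))"
proof -
  define c where "c = 1 / real CARD('n)"
  have "\<eta> * \<sigma>s \<le> \<eta> * \<sigma>"
    using \<eta> le by simp
  with noise have "infnorm (c *\<^sub>R (transpose G *v \<epsilon>)) \<le> \<eta> * \<sigma>"
    by (simp add: c_def)
  moreover have "bs \<in> B \<sigma>"
    using monotone_onD[OF mono, of \<sigma>s \<sigma>] bs \<sigma>s le by auto
  ultimately have "adds_feasible G H B \<eta> \<sigma> bs"
    by (simp add: adds_feasible_def H c_def)
  then have l1: "l1_norm b \<le> l1_norm bs"
    using b by (auto simp: is_arg_min_def not_less)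
  have feas: "infnorm (c *\<^sub>R (transpose G *v (H - G *v b))) \<le> \<eta> * \<sigma>"
    using b by (simp add: is_arg_min_def adds_feasible_def c_def)
  have "G *v (b - bs) = \<epsilon> - (H - G *v b)"
    by (simp add: H matrix_vector_mult_diff_distrib)
  then have "transpose G *v (G *v (b - bs)) = transpose G *v \<epsilon> - transpose G *v (H - G *v b)"
    by (simp only: matrix_vector_mult_diff_distrib[of "transpose G"])
  then have "c *\<^sub>R (transpose G *v (G *v (b - bs)))
      = c *\<^sub>R (transpose G *v \<epsilon>) + - (c *\<^sub>R (transpose G *v (H - G *v b)))"
    by (simp only: scaleR_right_diff_distrib add_uminus_conv_diff)
  then have "infnorm (c *\<^sub>R (transpose G *v (G *v (b - bs))))
      \<le> infnorm (c *\<^sub>R (transpose G *v \<epsilon>)) + infnorm (c *\<^sub>R (transpose G *v (H - G *v b)))"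
    by (metis infnorm_triangle infnorm_neg)
  also have "\<dots> \<le> \<eta> * (\<sigma> + \<sigma>s)"
    using noise feas by (simp add: c_def distrib_left)
  finally have corr: "infnorm ((1 / real CARD('n)) *\<^sub>R (transpose G *v (G *v (b - bs))))
      \<le> \<eta> * (\<sigma> + \<sigma>s)"
    by (simp add: c_def)
  note bounds = restricted_eigenvalue_error_bound[OF \<kappa> re l1 corr]
  show "norm (G *v (b - bs))
      \<le> 2 * (\<eta> * (\<sigma> + \<sigma>s)) * sqrt (real CARD('n) * real (l0_norm bs) / \<kappa>)"
    and "l1_norm (b - bs) \<le> 4 * (\<eta> * (\<sigma> + \<sigma>s)) * real (l0_norm bs) / \<kappa>"
    by (fact bounds)+
  have "sqrt (real CARD('n) * real (l0_norm bs) / \<kappa>)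
      = sqrt (real CARD('n)) * sqrt (real (l0_norm bs) / \<kappa>)"
    by (simp add: real_sqrt_mult[symmetric])
  then have "2 * (\<eta> * (\<sigma> + \<sigma>s)) * sqrt (real CARD('n) * real (l0_norm bs) / \<kappa>)
      = ((\<sigma> + \<sigma>s) / 14 * sqrt (real CARD('n))) * (28 * \<eta> * sqrt (real (l0_norm bs) / \<kappa>))"
    by simp
  also have "\<dots> \<le> (\<sigma> + \<sigma>s) / 14 * sqrt (real CARD('n))"
    using sparse \<sigma>s le by (intro mult_left_le) simp_all
  finally show "norm (G *v (b - bs)) \<le> (\<sigma> + \<sigma>s) / 14 * sqrt (real CARD('n))"
    using bounds(1) by linarith
qed

section \<open>The selected scale\<close>

theorem theorem4:
  fixes H \<epsilon> :: "real ^ 'n"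
    and G :: "real ^ 'p ^ 'n"
    and bs bt :: "real ^ 'p"
    and B :: "real \<Rightarrow> (real ^ 'p) set"
    and bhat :: "real \<rightharpoonup> real ^ 'p"
    and \<eta> \<kappa> \<sigma>s \<sigma>t \<sigma>h :: real
  assumes "H = G *v bs + \<epsilon>"
    and "mono_on {0..} B"
    and "\<eta> > 0" and "\<kappa> > 0" and "\<sigma>s > 0"
    and "infnorm ((1 / real CARD('n)) *\<^sub>R (transpose G *v \<epsilon>)) \<le> \<eta> * \<sigma>s"
    and "3 * \<sigma>s\<^sup>2 / 4 \<le> (norm \<epsilon>)\<^sup>2 / real CARD('n)"
    and "(norm \<epsilon>)\<^sup>2 / real CARD('n) \<le> 2 * \<sigma>s\<^sup>2"
    and "bs \<in> B \<sigma>s"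
    and "28 * \<eta> * sqrt (real (l0_norm bs) / \<kappa>) \<le> 1"
    and "restricted_eigenvalue G (l0_norm bs) \<ge> ereal \<kappa>"
    and "adds_selection G H B \<eta> bhat"
    and "\<sigma>s \<in> dom bhat"
    and "adds_scale G H bhat \<sigma>t"
    and "bhat \<sigma>t = Some bt"
    and "\<sigma>h = norm (H - G *v bt) / sqrt (real CARD('n))"
  shows "\<sigma>s \<le> \<sigma>t \<and> \<sigma>t \<le> 3 * \<sigma>s
    \<and> norm (G *v (bt - bs)) \<le> 8 * \<sigma>s * \<eta> * sqrt (real CARD('n) * real (l0_norm bs) / \<kappa>)
    \<and> l1_norm (bt - bs) \<le> 16 * \<eta> * \<sigma>s * real (l0_norm bs) / \<kappa>
    \<and> \<sigma>s / sqrt 2 \<le> \<sigma>h \<and> \<sigma>h \<le> 2 * \<sigma>s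
    \<and> infnorm ((1 / real CARD('n)) *\<^sub>R (transpose G *v (H - G *v bt))) / \<sigma>h \<le> 3 * sqrt 2 * \<eta>"
proof -
  note H = assms(1) and \<eta> = assms(3) and \<kappa> = assms(4) and \<sigma>s = assms(5)
  define w where "w = sqrt (real CARD('n))"
  have w: "w > 0" and w2: "w\<^sup>2 = real CARD('n)"
    by (simp_all add: w_def)
  have arg_min: "is_arg_min l1_norm (adds_feasible G H B \<eta> \<sigma>) b" if "bhat \<sigma> = Some b" for \<sigma> b
    using assms(12) that by (auto simp: adds_selection_def)
  note error = adds_error_bounds[OF H assms(2) \<eta> \<kappa> less_imp_le[OF \<sigma>s] _ assms(6,9,10,11) arg_min]
  have residual: "H - G *v b = \<epsilon> - G *v (b - bs)" for b
    by (simp add: H matrix_vector_mult_diff_distrib)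
  \<comment> \<open>The rationals \<open>1.42 > sqrt 2\<close> and \<open>0.86 < sqrt 3 / 2\<close> are close enough for every margin below.\<close>
  have r2: "sqrt 2 \<le> (1.42 :: real)"
    by (rule real_le_lsqrt) (simp_all add: power2_eq_square)
  have sw2: "0 \<le> \<sigma>s\<^sup>2 * w\<^sup>2"
    by simp
  have noise_ge: "norm \<epsilon> \<ge> 0.86 * \<sigma>s * w"
  proof (rule power2_le_imp_le)
    have "(0.86 * \<sigma>s * w)\<^sup>2 \<le> 3 * \<sigma>s\<^sup>2 / 4 * w\<^sup>2"
      using sw2 by (simp add: power_mult_distrib power_divide)
    also have "\<dots> \<le> (norm \<epsilon>)\<^sup>2"
      using assms(7) by (simp add: w2 pos_le_divide_eq)
    finally show "(0.86 * \<sigma>s * w)\<^sup>2 \<le> (norm \<epsilon>)\<^sup>2" .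
  qed simp
  have noise_le: "norm \<epsilon> \<le> 1.42 * \<sigma>s * w"
  proof (rule power2_le_imp_le)
    have "(norm \<epsilon>)\<^sup>2 \<le> 2 * \<sigma>s\<^sup>2 * w\<^sup>2"
      using assms(8) by (simp add: w2 pos_divide_le_eq)
    also have "\<dots> \<le> (1.42 * \<sigma>s * w)\<^sup>2"
      using sw2 by (simp add: power_mult_distrib power_divide)
    finally show "(norm \<epsilon>)\<^sup>2 \<le> (1.42 * \<sigma>s * w)\<^sup>2" .
  qed (use \<sigma>s w in simp)
  have "\<sigma>s \<le> \<sigma>t"
  proof -
    obtain b where b: "bhat \<sigma>s = Some b"
      using assms(13) by auto
    have "norm (G *v (b - bs)) \<le> (\<sigma>s + \<sigma>s) / 14 * w"
      unfolding w_def by (rule error(3)[OF _ b]) simp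
    moreover have "norm \<epsilon> - norm (G *v (b - bs)) \<le> norm (H - G *v b)"
      unfolding residual by (rule norm_triangle_ineq2)
    moreover have "0 < \<sigma>s * w"
      using \<sigma>s w by simp
    \<comment> \<open>\<open>0.86 - 1 / 7 > 0.71 > 1 / sqrt 2\<close>\<close>
    ultimately have "0.71 * (\<sigma>s * w) \<le> norm (H - G *v b)"
      using noise_ge by (simp add: field_simps)
    then have "(0.71 * (\<sigma>s * w))\<^sup>2 \<le> (norm (H - G *v b))\<^sup>2"
      using \<sigma>s w by (intro power_mono) simp_all
    moreover have "w\<^sup>2 * \<sigma>s\<^sup>2 / 2 \<le> (0.71 * (\<sigma>s * w))\<^sup>2"
      using sw2 by (simp add: power_mult_distrib power_divide)
    ultimately have "real CARD('n) * \<sigma>s\<^sup>2 / 2 \<le> (norm (H - G *v b))\<^sup>2"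
      by (simp add: w2)
    then show ?thesis
      using assms(14) b less_imp_le[OF \<sigma>s] unfolding adds_scale_def is_arg_max_def not_less
      by (meson not_le)
  qed
  note error_t = error[OF this assms(15)]
  have \<sigma>t: "\<sigma>t > 0"
    using \<open>\<sigma>s \<le> \<sigma>t\<close> \<sigma>s by simp
  have resid: "norm (H - G *v bt) = \<sigma>h * w"
    using assms(16) w by (simp add: w_def)
  have \<sigma>h0: "\<sigma>h \<ge> 0"
    using assms(16) by simp
  have "real CARD('n) * \<sigma>t\<^sup>2 / 2 \<le> (norm (H - G *v bt))\<^sup>2"
    using assms(14,15) by (auto simp: adds_scale_def is_arg_max_def)
  then have "(\<sigma>t\<^sup>2 / 2) * w\<^sup>2 \<le> \<sigma>h\<^sup>2 * w\<^sup>2"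
    by (simp add: resid w2[symmetric] power_mult_distrib mult.commute)
  then have "(\<sigma>t / sqrt 2)\<^sup>2 \<le> \<sigma>h\<^sup>2"
    using w by (simp add: power_divide)
  then have \<sigma>h_ge: "\<sigma>t / sqrt 2 \<le> \<sigma>h"
    using \<sigma>h0 by (rule power2_le_imp_le)
  then have \<sigma>t_le: "\<sigma>t \<le> \<sigma>h * sqrt 2"
    by (simp add: pos_divide_le_eq)
  have "\<sigma>h * w \<le> norm \<epsilon> + norm (G *v (bt - bs))"
    unfolding resid[symmetric] residual by (rule norm_triangle_ineq4)
  also have "\<dots> \<le> 1.42 * \<sigma>s * w + (\<sigma>t + \<sigma>s) / 14 * w"
    using noise_le error_t(3) by (simp add: w_def)
  also have "\<dots> = (1.42 * \<sigma>s + (\<sigma>t + \<sigma>s) / 14) * w"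
    by (simp add: distrib_right)
  finally have \<sigma>h_le: "\<sigma>h \<le> 1.42 * \<sigma>s + (\<sigma>t + \<sigma>s) / 14"
    using w by simp
  have "\<sigma>h * sqrt 2 \<le> \<sigma>h * 1.42"
    using r2 \<sigma>h0 by (intro mult_left_mono)
  \<comment> \<open>Since \<open>1.42 / 14 < 1\<close>, the occurrence of \<open>\<sigma>t\<close> in the upper bound for \<open>\<sigma>h\<close> can be absorbed.\<close>
  with \<sigma>t_le have "\<sigma>t \<le> \<sigma>h * 1.42"
    by (rule order_trans)
  then have upper: "\<sigma>t \<le> 3 * \<sigma>s"
    using \<sigma>h_le \<sigma>s by (simp add: field_simps)
  have sum_le: "\<eta> * (\<sigma>t + \<sigma>s) \<le> 4 * \<eta> * \<sigma>s"
    using mult_left_mono[of "\<sigma>t + \<sigma>s" "4 * \<sigma>s" \<eta>] upper \<eta> by simp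
  have "2 * (\<eta> * (\<sigma>t + \<sigma>s)) * sqrt (real CARD('n) * real (l0_norm bs) / \<kappa>)
      \<le> 2 * (4 * \<eta> * \<sigma>s) * sqrt (real CARD('n) * real (l0_norm bs) / \<kappa>)"
    using sum_le \<kappa> by (intro mult_right_mono mult_left_mono) simp_all
  then have prediction:
    "norm (G *v (bt - bs)) \<le> 8 * \<sigma>s * \<eta> * sqrt (real CARD('n) * real (l0_norm bs) / \<kappa>)"
    using error_t(1) by (simp add: mult.assoc mult.left_commute)
  have "4 * (\<eta> * (\<sigma>t + \<sigma>s)) * real (l0_norm bs) / \<kappa>
      \<le> 4 * (4 * \<eta> * \<sigma>s) * real (l0_norm bs) / \<kappa>"
    using sum_le \<kappa> by (intro divide_right_mono mult_right_mono mult_left_mono) simp_all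
  then have estimation: "l1_norm (bt - bs) \<le> 16 * \<eta> * \<sigma>s * real (l0_norm bs) / \<kappa>"
    using error_t(2) by (simp add: mult.assoc)
  have "\<sigma>s / sqrt 2 \<le> \<sigma>t / sqrt 2"
    using \<open>\<sigma>s \<le> \<sigma>t\<close> by (simp add: divide_right_mono)
  then have lower_h: "\<sigma>s / sqrt 2 \<le> \<sigma>h"
    using \<sigma>h_ge by linarith
  have upper_h: "\<sigma>h \<le> 2 * \<sigma>s"
    using \<sigma>h_le upper \<sigma>s by (simp add: field_simps)
  have "\<sigma>t / sqrt 2 > 0"
    using \<sigma>t by simp
  then have \<sigma>h: "\<sigma>h > 0"
    using \<sigma>h_ge by linarith
  have "infnorm ((1 / real CARD('n)) *\<^sub>R (transpose G *v (H - G *v bt))) \<le> \<eta> * \<sigma>t"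
    using arg_min[OF assms(15)] by (simp add: is_arg_min_def adds_feasible_def)
  also have "\<dots> \<le> \<eta> * (\<sigma>h * sqrt 2)"
    using \<sigma>t_le \<eta> by simp
  also have "\<dots> \<le> 3 * sqrt 2 * \<eta> * \<sigma>h"
    using \<eta> \<sigma>h by simp
  finally have "infnorm ((1 / real CARD('n)) *\<^sub>R (transpose G *v (H - G *v bt))) / \<sigma>h
      \<le> 3 * sqrt 2 * \<eta>"
    using \<sigma>h by (simp add: pos_divide_le_eq)
  then show ?thesis
    using \<open>\<sigma>s \<le> \<sigma>t\<close> upper prediction estimation lower_h upper_h by blast
qed

end
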